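(* Let $q$ be a prime power and $m,n$ positive integers. Suppose $\mathcal{V}\in E_v(q^m,n)$ and $\mathbf{u}\in\mathcal{V}$ has rank $v$, and fix $0\le a\le v$. For any $\mathcal{A}\in E_a(q^m,n)$ and $\mathcal{B}\in E_{v-a}(q^m,n)$ such that $\mathcal{A}\oplus\mathcal{B}=\mathcal{V}$, define $f_{\mathbf{u}}(\mathcal{A},\mathcal{B})=\mathbf{u}_{\mathcal{A}}$ and $g_{\mathbf{u}}(\mathcal{A},\mathcal{B})=\mathbf{u}_{\mathcal{B}}$. Then both $f_{\mathbf{u}}$ and $g_{\mathbf{u}}$ are injective functions on the set of such pairs $(\mathcal{A},\mathcal{B})$.
   Context: The rank of $\mathbf{x}\in\mathrm{GF}(q^m)^n$ is the maximum number of coordinates of $\mathbf{x}$ that are linearly independent over $\mathrm{GF}(q)$. A $\mathrm{GF}(q^m)$-linear subspace of $\mathrm{GF}(q^m)^n$ is an elementary linear subspace (ELS) if it has a basis consisting of vectors in $\mathrm{GF}(q)^n$. $E_v(q^m,n)$ denotes the set of all ELS's of $\mathrm{GF}(q^m)^n$ with dimension $v$. For $\mathcal{A}\oplus\mathcal{B}=\mathcal{V}$ and $\mathbf{u}\in\mathcal{V}$, $\mathbf{u}_{\mathcal{A}}$ denotes the projection of $\mathbf{u}$ on $\mathcal{A}$ along $\mathcal{B}$ and $\mathbf{u}_{\mathcal{B}}$ the projection of $\mathbf{u}$ on $\mathcal{B}$ along $\mathcal{A}$, so $\mathbf{u}=\mathbf{u}_{\mathcal{A}}+\mathbf{u}_{\mathcal{B}}$.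 *)

theory Defs
  imports "HOL-Analysis.Analysis" "HOL-Number_Theory.Prime_Powers"
begin

text \<open>
  The field \<open>GF(q^m)\<close> is a finite field type \<open>'a\<close> with \<open>CARD('a) = q ^ m\<close>; its subfield \<open>GF(q)\<close> is
  a subset \<open>F\<close> of \<open>'a\<close> that is a subfield with \<open>q\<close> elements; the space \<open>GF(q^m)^n\<close> is \<open>'a ^ 'n\<close>.
\<close>

definition is_subfield :: "'a::field set \<Rightarrow> bool" where
  "is_subfield F \<longleftrightarrow>
     0 \<in> F \<and> 1 \<in> F \<and>
     (\<forall>x\<in>F. \<forall>y\<in>F. x + y \<in> F \<and> x * y \<in> F) \<and>
     (\<forall>x\<in>F. - x \<in> F \<and> inverse x \<in> F)"

text \<open>
  Independence is that of the indexed family of coordinates: two equal coordinates in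
  different positions are dependent.
\<close>

definition coords_independent :: "'a::field set \<Rightarrow> 'a ^ 'n::finite \<Rightarrow> 'n set \<Rightarrow> bool" where
  "coords_independent F x I \<longleftrightarrow>
     (\<forall>c. (\<forall>i\<in>I. c i \<in> F) \<and> (\<Sum>i\<in>I. c i * x $ i) = 0 \<longrightarrow> (\<forall>i\<in>I. c i = 0))"

definition rank_over :: "'a::field set \<Rightarrow> 'a ^ 'n::finite \<Rightarrow> nat" where
  "rank_over F x = Max {card I | I. coords_independent F x I}"

definition is_ELS :: "'a::field set \<Rightarrow> ('a ^ 'n::finite) set \<Rightarrow> bool" where
  "is_ELS F V \<longleftrightarrow>
     vec.subspace V \<and>
     (\<exists>B. vec.independent B \<and> vec.span B = V \<and> (\<forall>b\<in>B. \<forall>i. b $ i \<in> F))"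

definition ELS :: "'a::field set \<Rightarrow> nat \<Rightarrow> ('a ^ 'n::finite) set set" where
  "ELS F v = {V. is_ELS F V \<and> vec.dim V = v}"

definition is_direct_sum ::
    "('a::field ^ 'n::finite) set \<Rightarrow> ('a ^ 'n) set \<Rightarrow> ('a ^ 'n) set \<Rightarrow> bool" where
  "is_direct_sum A B V \<longleftrightarrow>
     vec.subspace A \<and> vec.subspace B \<and> A \<inter> B = {0} \<and> V = {a + b | a b. a \<in> A \<and> b \<in> B}"

text \<open>
  \<open>proj_along A B u\<close> is the projection of \<open>u\<close> on \<open>A\<close> along \<open>B\<close>; it is meaningful only for
  \<open>u\<close> in the direct sum of \<open>A\<close> and \<open>B\<close>.
\<close>

definition proj_along ::
    "('a::field ^ 'n::finite) set \<Rightarrow> ('a ^ 'n) set \<Rightarrow> 'a ^ 'n \<Rightarrow> 'a ^ 'n" where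
  "proj_along A B u = (THE x. x \<in> A \<and> (\<exists>y\<in>B. u = x + y))"

definition ELS_decompositions ::
    "'a::field set \<Rightarrow> nat \<Rightarrow> nat \<Rightarrow> ('a ^ 'n::finite) set \<Rightarrow> (('a ^ 'n) set \<times> ('a ^ 'n) set) set" where
  "ELS_decompositions F a b V =
     {(A, B). A \<in> ELS F a \<and> B \<in> ELS F b \<and> is_direct_sum A B V}"

definition f_proj ::
    "'a::field ^ 'n::finite \<Rightarrow> ('a ^ 'n) set \<times> ('a ^ 'n) set \<Rightarrow> 'a ^ 'n" where
  "f_proj u = (\<lambda>(A, B). proj_along A B u)"

definition g_proj ::
    "'a::field ^ 'n::finite \<Rightarrow> ('a ^ 'n) set \<times> ('a ^ 'n) set \<Rightarrow> 'a ^ 'n" where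
  "g_proj u = (\<lambda>(A, B). proj_along B A u)"

end

theory Submission
  imports Defs
begin

text \<open>
  Write \<open>u = \<Sum>\<^sub>s \<alpha>\<^sub>s s\<close> in a basis of \<open>V\<close> in \<open>GF(q)\<^sup>n\<close> that joins one of \<open>A\<close> and one of \<open>B\<close>. The
  \<open>q\<^sup>v\<close> distinct \<open>GF(q)\<close>-combinations of \<open>v\<close> independent coordinates of \<open>u\<close> are combinations of
  the \<open>v\<close> coefficients \<open>\<alpha>\<^sub>s\<close>, so by counting the \<open>\<alpha>\<^sub>s\<close> are independent over \<open>GF(q)\<close>. A functional
  that is 1 at one \<open>\<alpha>\<^sub>s\<close> and 0 at the others, applied to each coordinate of the component of \<open>u\<close>
  in \<open>A\<close>, returns the basis vector \<open>s\<close> and maps every elementary linear subspace into itself.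
  Hence \<open>A\<close> is the least elementary linear subspace that contains this component, and likewise for
  \<open>B\<close>; one component determines the other, since their sum is \<open>u\<close>.
\<close>

section \<open>Subfields and linear independence over them\<close>

lemma subfield_closed:
  assumes "is_subfield F"
  shows "0 \<in> F" "1 \<in> F"
    and "x \<in> F \<Longrightarrow> y \<in> F \<Longrightarrow> x + y \<in> F" "x \<in> F \<Longrightarrow> y \<in> F \<Longrightarrow> x * y \<in> F"
    and "x \<in> F \<Longrightarrow> - x \<in> F" "x \<in> F \<Longrightarrow> inverse x \<in> F"
    and "x \<in> F \<Longrightarrow> y \<in> F \<Longrightarrow> x - y \<in> F"
proof -
  show "x - y \<in> F" if "x \<in> F" "y \<in> F"
  proof -
    have "x + - y \<in> F" using that assms unfolding is_subfield_def by blast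
    then show ?thesis by simp
  qed
qed (use assms in \<open>unfold is_subfield_def, blast+\<close>)

lemma subfield_sum:
  assumes "is_subfield F" "\<And>i. i \<in> I \<Longrightarrow> f i \<in> F"
  shows "sum f I \<in> F"
  using assms(2)
  by (induction I rule: infinite_finite_induct) (simp_all add: subfield_closed[OF assms(1)])

text \<open>The condition of \<open>coords_independent\<close> for an arbitrary indexed family, so
  that it also covers expansion coefficients indexed by basis vectors.\<close>

definition subfield_independent :: "'a::field set \<Rightarrow> ('b \<Rightarrow> 'a) \<Rightarrow> 'b set \<Rightarrow> bool" where
  "subfield_independent F \<alpha> I \<longleftrightarrow>
     (\<forall>c. (\<forall>i\<in>I. c i \<in> F) \<and> (\<Sum>i\<in>I. c i * \<alpha> i) = 0 \<longrightarrow> (\<forall>i\<in>I. c i = 0))"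

lemma subfield_independentD:
  assumes "subfield_independent F \<alpha> I" "\<And>i. i \<in> I \<Longrightarrow> c i \<in> F" "(\<Sum>i\<in>I. c i * \<alpha> i) = 0" "i \<in> I"
  shows "c i = 0"
  using assms unfolding subfield_independent_def by blast

lemma coords_independent_iff:
  "coords_independent F x I \<longleftrightarrow> subfield_independent F (\<lambda>i. x $ i) I"
  by (simp add: coords_independent_def subfield_independent_def)

text \<open>An additive map is injective iff its kernel is trivial. This form turns independence
  into a counting statement; extensional functions are used because there are exactly
  \<open>card F ^ card I\<close> of them.\<close>

lemma subfield_independent_iff_inj_on:
  assumes F: "is_subfield F" and "finite I"
  shows "subfield_independent F \<alpha> I \<longleftrightarrow> inj_on (\<lambda>c. \<Sum>i\<in>I. c i * \<alpha> i) (I \<rightarrow>\<^sub>E F)"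
proof
  assume ind: "subfield_independent F \<alpha> I"
  show "inj_on (\<lambda>c. \<Sum>i\<in>I. c i * \<alpha> i) (I \<rightarrow>\<^sub>E F)"
  proof (rule inj_onI)
    fix c d assume c: "c \<in> I \<rightarrow>\<^sub>E F" and d: "d \<in> I \<rightarrow>\<^sub>E F"
      and eq: "(\<Sum>i\<in>I. c i * \<alpha> i) = (\<Sum>i\<in>I. d i * \<alpha> i)"
    have "c i - d i = 0" if "i \<in> I" for i
    proof (rule subfield_independentD[OF ind _ _ that])
      show "c j - d j \<in> F" if "j \<in> I" for j
        using that c d subfield_closed(7)[OF F] by (meson PiE_mem)
      show "(\<Sum>i\<in>I. (c i - d i) * \<alpha> i) = 0"
        using eq by (simp add: left_diff_distrib sum_subtractf)
    qed
    then show "c = d"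
      using c d by (intro PiE_ext[of c I "\<lambda>_. F" d]) auto
  qed
next
  assume inj: "inj_on (\<lambda>c. \<Sum>i\<in>I. c i * \<alpha> i) (I \<rightarrow>\<^sub>E F)"
  show "subfield_independent F \<alpha> I"
    unfolding subfield_independent_def
  proof (intro allI impI)
    fix c assume c: "(\<forall>i\<in>I. c i \<in> F) \<and> (\<Sum>i\<in>I. c i * \<alpha> i) = 0"
    have "restrict c I = restrict (\<lambda>_. 0) I"
      using c F by (intro inj_onD[OF inj]) (auto simp: subfield_closed[OF F])
    then show "\<forall>i\<in>I. c i = 0"
      by (metis restrict_apply')
  qed
qed

lemma subfield_independent_subset:
  assumes F: "is_subfield F" and ind: "subfield_independent F \<alpha> I" and "J \<subseteq> I" "finite I"
  shows "subfield_independent F \<alpha> J"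
  unfolding subfield_independent_def
proof (intro allI impI ballI)
  fix c j assume c: "(\<forall>i\<in>J. c i \<in> F) \<and> (\<Sum>i\<in>J. c i * \<alpha> i) = 0" and "j \<in> J"
  \<comment> \<open>A relation on \<open>J\<close> becomes one on \<open>I\<close> when extended by
    zero.\<close>
  define d where "d i = (if i \<in> J then c i else 0)" for i
  have "(\<Sum>i\<in>I. d i * \<alpha> i) = (\<Sum>i\<in>J. c i * \<alpha> i)"
    using assms(3,4) by (intro sum.mono_neutral_cong_right) (auto simp: d_def)
  then have "d j = 0"
    using c \<open>j \<in> J\<close> \<open>J \<subseteq> I\<close> F
    by (intro subfield_independentD[OF ind, of d j]) (auto simp: d_def subfield_closed[OF F])
  then show "c j = 0"
    using \<open>j \<in> J\<close> by (simp add: d_def)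
qed

section \<open>Rank and the independence of expansion coefficients\<close>

lemma rank_over_attained:
  obtains I where "coords_independent F x I" "card I = rank_over F x"
proof -
  have "card {} \<in> {card I | I. coords_independent F x I}"
    by (auto simp: coords_independent_def intro!: exI[of _ "{}"])
  moreover have "finite {card I | I. coords_independent F x I}"
    by (rule finite_subset[of _ "range card"]) auto
  ultimately have "rank_over F x \<in> {card I | I. coords_independent F x I}"
    unfolding rank_over_def by (intro Max_in) auto
  then show thesis
    using that by auto
qed

text \<open>Independent coordinates of the vector have \<open>card F ^ rank\<close> distinct
  combinations over \<open>F\<close>. All of them are values of \<open>?h\<close>, whose domain has
  only \<open>card F ^ card S\<close> elements. With \<open>card S\<close> at most the rank, no two
  elements of this domain can share a value.\<close>

lemma coefficients_independent:
  fixes F :: "'a::{field,finite} set" and S :: "('a ^ 'n::finite) set"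
  assumes F: "is_subfield F" and S: "\<And>s i. s \<in> S \<Longrightarrow> s $ i \<in> F"
    and rank: "card S \<le> rank_over F (\<Sum>s\<in>S. \<alpha> s *s s)"
  shows "subfield_independent F \<alpha> S"
proof -
  define u where "u = (\<Sum>s\<in>S. \<alpha> s *s s)"
  obtain I where I: "coords_independent F u I" "card I = rank_over F u"
    by (rule rank_over_attained)
  let ?g = "\<lambda>c. \<Sum>i\<in>I. c i * u $ i" and ?h = "\<lambda>d. \<Sum>s\<in>S. d s * \<alpha> s"
  have "F \<noteq> {}"
    using subfield_closed(1)[OF F] by blast
  then have "card F > 0"
    by (simp add: card_gt_0_iff)
  have "?g ` (I \<rightarrow>\<^sub>E F) \<subseteq> ?h ` (S \<rightarrow>\<^sub>E F)"
  proof (rule image_subsetI)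
    fix c assume c: "c \<in> I \<rightarrow>\<^sub>E F"
    \<comment> \<open>Expanding each \<open>u $ i\<close> and exchanging the sums makes this the
      coefficient of \<open>\<alpha> s\<close> in \<open>?g c\<close>; it lies in \<open>F\<close>
      because the vectors of \<open>S\<close> have entries in \<open>F\<close>.\<close>
    let ?d = "restrict (\<lambda>s. \<Sum>i\<in>I. c i * s $ i) S"
    have "?d \<in> S \<rightarrow>\<^sub>E F"
      using c by (auto intro!: subfield_sum[OF F] subfield_closed(4)[OF F] S intro: PiE_mem)
    moreover have "?g c = ?h ?d"
    proof -
      have "?g c = (\<Sum>i\<in>I. \<Sum>s\<in>S. c i * (\<alpha> s * s $ i))"
        by (simp add: u_def sum_distrib_left)
      also have "\<dots> = (\<Sum>s\<in>S. \<Sum>i\<in>I. c i * (\<alpha> s * s $ i))"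
        by (rule sum.swap)
      also have "\<dots> = ?h ?d"
        by (intro sum.cong) (simp_all add: sum_distrib_left mult_ac)
      finally show ?thesis .
    qed
    ultimately show "?g c \<in> ?h ` (S \<rightarrow>\<^sub>E F)"
      by blast
  qed
  then have "card (?g ` (I \<rightarrow>\<^sub>E F)) \<le> card (?h ` (S \<rightarrow>\<^sub>E F))"
    by (intro card_mono finite)
  moreover have "card (?g ` (I \<rightarrow>\<^sub>E F)) = card (I \<rightarrow>\<^sub>E F)"
    using I(1) by (intro card_image)
      (simp add: coords_independent_iff flip: subfield_independent_iff_inj_on[OF F])
  moreover have "card (I \<rightarrow>\<^sub>E F) = card F ^ card I" "card (S \<rightarrow>\<^sub>E F) = card F ^ card S"
    by (simp_all add: card_funcsetE)
  moreover have "card F ^ card S \<le> card F ^ card I"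
    using rank I(2) \<open>card F > 0\<close> by (intro power_increasing) (auto simp: u_def)
  moreover have "card (?h ` (S \<rightarrow>\<^sub>E F)) \<le> card (S \<rightarrow>\<^sub>E F)"
    by (intro card_image_le finite_PiE) auto
  ultimately have "card (?h ` (S \<rightarrow>\<^sub>E F)) = card (S \<rightarrow>\<^sub>E F)"
    by linarith
  then have "inj_on ?h (S \<rightarrow>\<^sub>E F)"
    by (intro eq_card_imp_inj_on finite_PiE) auto
  then show ?thesis
    by (simp add: subfield_independent_iff_inj_on[OF F])
qed

section \<open>Linear functionals over the subfield\<close>

text \<open>The field itself is regarded here as a vector space over \<open>F\<close>.\<close>

definition subfield_subspace :: "'a::field set \<Rightarrow> 'a set \<Rightarrow> bool" where
  "subfield_subspace F U \<longleftrightarrow>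
     0 \<in> U \<and> (\<forall>x\<in>U. \<forall>y\<in>U. x + y \<in> U) \<and> (\<forall>c\<in>F. \<forall>x\<in>U. c * x \<in> U)"

text \<open>An element of the dual space over \<open>F\<close>; since \<open>F\<close> is a set and
  not a type, the codomain is expressed through the range.\<close>

definition subfield_functional :: "'a::field set \<Rightarrow> ('a \<Rightarrow> 'a) \<Rightarrow> bool" where
  "subfield_functional F \<phi> \<longleftrightarrow>
     range \<phi> \<subseteq> F \<and> (\<forall>x y. \<phi> (x + y) = \<phi> x + \<phi> y) \<and> (\<forall>c\<in>F. \<forall>x. \<phi> (c * x) = c * \<phi> x)"

lemma subfield_functional_sum:
  assumes F: "is_subfield F" and \<phi>: "subfield_functional F \<phi>" and c: "\<And>i. i \<in> I \<Longrightarrow> c i \<in> F"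
  shows "\<phi> (\<Sum>i\<in>I. x i * c i) = (\<Sum>i\<in>I. \<phi> (x i) * c i)"
proof -
  have "\<phi> (0 * 0) = 0 * \<phi> 0"
    using subfield_closed(1)[OF F] \<phi> unfolding subfield_functional_def by blast
  then have "\<phi> 0 = 0" by simp
  with c show ?thesis
    by (induction I rule: infinite_finite_induct)
      (use \<phi> in \<open>auto simp: subfield_functional_def mult.commute\<close>)
qed

text \<open>
  If \<open>U\<close> is a maximal \<open>F\<close>-subspace that avoids \<open>z\<close>, then the whole field is \<open>U \<oplus> F z\<close>, and the
  coefficient of \<open>z\<close> is the functional.
\<close>

lemma subfield_functional_exists:
  fixes F :: "'a::{field,finite} set"
  assumes F: "is_subfield F" and "subfield_subspace F U\<^sub>0" "z \<notin> U\<^sub>0"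
  obtains \<phi> where "subfield_functional F \<phi>" "\<And>x. x \<in> U\<^sub>0 \<Longrightarrow> \<phi> x = 0" "\<phi> z = 1"
proof -
  have F0: "0 \<in> F" and F1: "1 \<in> F"
    and Fadd: "\<And>x y. x \<in> F \<Longrightarrow> y \<in> F \<Longrightarrow> x + y \<in> F"
    and Fmul: "\<And>x y. x \<in> F \<Longrightarrow> y \<in> F \<Longrightarrow> x * y \<in> F"
    and Fneg: "\<And>x. x \<in> F \<Longrightarrow> - x \<in> F" and Finv: "\<And>x. x \<in> F \<Longrightarrow> inverse x \<in> F"
    by (simp_all add: subfield_closed[OF F])
  let ?C = "{U. subfield_subspace F U \<and> U\<^sub>0 \<subseteq> U \<and> z \<notin> U}"
  \<comment> \<open>The field is finite, so \<open>?C\<close>, which contains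
    \<open>U\<^sub>0\<close>, has a maximal element.\<close>
  obtain U where U: "U \<in> ?C" and max: "\<And>U'. U' \<in> ?C \<Longrightarrow> U \<subseteq> U' \<Longrightarrow> U = U'"
    using finite_has_maximal2[of ?C U\<^sub>0] assms by auto
  have U0: "0 \<in> U" and Uadd: "\<And>x y. x \<in> U \<Longrightarrow> y \<in> U \<Longrightarrow> x + y \<in> U"
    and Umul: "\<And>c x. c \<in> F \<Longrightarrow> x \<in> U \<Longrightarrow> c * x \<in> U"
    using U by (auto simp: subfield_subspace_def)
  have Udiff: "x - y \<in> U" if "x \<in> U" "y \<in> U" for x y
    using Uadd[OF that(1) Umul[OF Fneg[OF F1] that(2)]] by simp
  have ex: "\<exists>c\<in>F. w - c * z \<in> U" for w
  proof (cases "w \<in> U")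
    case True
    then show ?thesis using F0 by (intro bexI[of _ 0]) auto
  next
    case False
    \<comment> \<open>\<open>U + F w\<close> strictly contains \<open>U\<close>, so by maximality it
      contains \<open>z\<close>. In \<open>z = t + c * w\<close> the scalar \<open>c\<close> is
      nonzero because \<open>z\<close> is outside \<open>U\<close>, and solving for \<open>w\<close>
      gives the coefficient \<open>inverse c\<close>.\<close>
    let ?U' = "{t + c * w | t c. t \<in> U \<and> c \<in> F}"
    have "U \<subseteq> ?U'"
    proof
      fix t assume "t \<in> U"
      then have "t = t + 0 * w \<and> t \<in> U \<and> 0 \<in> F" using F0 by simp
      then show "t \<in> ?U'" by blast
    qed
    moreover have "w \<in> ?U'"
    proof -
      have "w = 0 + 1 * w \<and> 0 \<in> U \<and> 1 \<in> F" using U0 F1 by simp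
      then show ?thesis by blast
    qed
    moreover have "subfield_subspace F ?U'"
      unfolding subfield_subspace_def
    proof (intro conjI ballI)
      show "0 \<in> ?U'" using U0 \<open>U \<subseteq> ?U'\<close> by blast
    next
      fix x y assume "x \<in> ?U'" "y \<in> ?U'"
      then obtain t c t' c' where *: "x = t + c * w" "y = t' + c' * w"
        "t \<in> U" "c \<in> F" "t' \<in> U" "c' \<in> F" by blast
      have "x + y = (t + t') + (c + c') * w" by (simp add: * algebra_simps)
      then show "x + y \<in> ?U'" using * Uadd Fadd by blast
    next
      fix d x assume "d \<in> F" "x \<in> ?U'"
      then obtain t c where *: "x = t + c * w" "t \<in> U" "c \<in> F" by blast
      have "d * x = d * t + (d * c) * w" by (simp add: * algebra_simps)
      then show "d * x \<in> ?U'" using * \<open>d \<in> F\<close> Umul Fmul by blast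
    qed
    ultimately have "z \<in> ?U'"
      using max[of ?U'] U False by blast
    then obtain t c where tc: "z = t + c * w" "t \<in> U" "c \<in> F" by blast
    have "c \<noteq> 0" using tc U by auto
    then have "w - inverse c * z = (- inverse c) * t"
      by (simp add: tc field_simps)
    also have "\<dots> \<in> U"
      by (rule Umul[OF Fneg[OF Finv[OF tc(3)]] tc(2)])
    finally show ?thesis
      using Finv[OF tc(3)] by blast
  qed
  have uniq: "c = d" if "c \<in> F" "d \<in> F" "w - c * z \<in> U" "w - d * z \<in> U" for w c d
  proof (rule ccontr)
    assume "c \<noteq> d"
    have "(d - c) * z \<in> U"
      using Udiff[OF that(3,4)] by (simp add: algebra_simps)
    then have "inverse (d - c) * ((d - c) * z) \<in> U"
      by (rule Umul[OF Finv[OF subfield_closed(7)[OF F that(2,1)]]])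
    then show False using \<open>c \<noteq> d\<close> U by (simp flip: mult.assoc)
  qed
  define \<phi> where "\<phi> w = (SOME c. c \<in> F \<and> w - c * z \<in> U)" for w
  have \<phi>: "\<phi> w \<in> F" "w - \<phi> w * z \<in> U" for w
    using ex[of w] someI_ex[of "\<lambda>c. c \<in> F \<and> w - c * z \<in> U"] unfolding \<phi>_def by blast+
  have \<phi>_eqI: "\<phi> w = c" if "c \<in> F" "w - c * z \<in> U" for w c
    using uniq[OF \<phi>(1) that(1) \<phi>(2) that(2)] .
  have "subfield_functional F \<phi>"
    unfolding subfield_functional_def
  proof (intro conjI allI ballI)
    show "range \<phi> \<subseteq> F" using \<phi> by auto
    show "\<phi> (x + y) = \<phi> x + \<phi> y" for x y
      using Uadd[OF \<phi>(2)[of x] \<phi>(2)[of y]] by (intro \<phi>_eqI Fadd \<phi>(1)) (simp add: algebra_simps)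
    show "\<phi> (c * x) = c * \<phi> x" if "c \<in> F" for c x
      using Umul[OF that \<phi>(2)[of x]] that by (intro \<phi>_eqI Fmul \<phi>(1)) (simp_all add: algebra_simps)
  qed
  moreover have "\<phi> x = 0" if "x \<in> U\<^sub>0" for x
    using that U F0 by (intro \<phi>_eqI) auto
  moreover have "\<phi> z = 1"
    using U0 F1 by (intro \<phi>_eqI) auto
  ultimately show thesis by (rule that)
qed

text \<open>Independence keeps \<open>\<alpha> s\<close> outside the \<open>F\<close>-span of the
  other members of the family, so a functional can vanish on that span and be 1 at
  \<open>\<alpha> s\<close>.\<close>

lemma dual_functional_exists:
  fixes F :: "'a::{field,finite} set"
  assumes F: "is_subfield F" and ind: "subfield_independent F \<alpha> S" and "finite S" "s \<in> S"
  obtains \<phi> where "subfield_functional F \<phi>" "\<phi> (\<alpha> s) = 1" "\<And>t. t \<in> S - {s} \<Longrightarrow> \<phi> (\<alpha> t) = 0"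
proof -
  let ?S = "S - {s}"
  let ?U = "{(\<Sum>t\<in>?S. c t * \<alpha> t) | c. \<forall>t\<in>?S. c t \<in> F}"
  have "subfield_subspace F ?U"
    unfolding subfield_subspace_def
  proof (intro conjI ballI)
    have "0 = (\<Sum>t\<in>?S. 0 * \<alpha> t) \<and> (\<forall>t\<in>?S. 0 \<in> F)"
      by (simp add: subfield_closed[OF F])
    then show "0 \<in> ?U" by (intro CollectI exI[of _ "\<lambda>_. 0"])
  next
    fix x y assume "x \<in> ?U" "y \<in> ?U"
    then obtain c d where *: "x = (\<Sum>t\<in>?S. c t * \<alpha> t)" "y = (\<Sum>t\<in>?S. d t * \<alpha> t)"
      "\<forall>t\<in>?S. c t \<in> F" "\<forall>t\<in>?S. d t \<in> F" by blast
    have "x + y = (\<Sum>t\<in>?S. (c t + d t) * \<alpha> t) \<and> (\<forall>t\<in>?S. c t + d t \<in> F)"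
      using * F by (simp add: subfield_closed[OF F] distrib_right sum.distrib)
    then show "x + y \<in> ?U" by (intro CollectI exI[of _ "\<lambda>t. c t + d t"])
  next
    fix d x assume "d \<in> F" "x \<in> ?U"
    then obtain c where *: "x = (\<Sum>t\<in>?S. c t * \<alpha> t)" "\<forall>t\<in>?S. c t \<in> F" by blast
    have "d * x = (\<Sum>t\<in>?S. (d * c t) * \<alpha> t) \<and> (\<forall>t\<in>?S. d * c t \<in> F)"
      using * F \<open>d \<in> F\<close> by (simp add: subfield_closed[OF F] sum_distrib_left mult.assoc)
    then show "d * x \<in> ?U" by (intro CollectI exI[of _ "\<lambda>t. d * c t"])
  qed
  moreover have "\<alpha> s \<notin> ?U"
  proof
    assume "\<alpha> s \<in> ?U"
    then obtain c where c: "\<alpha> s = (\<Sum>t\<in>?S. c t * \<alpha> t)" "\<forall>t\<in>?S. c t \<in> F" by blast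
    \<comment> \<open>Moving \<open>\<alpha> s\<close> to the other side yields a relation over
      \<open>F\<close> whose coefficient at \<open>s\<close> is -1.\<close>
    define d where "d = c(s := - 1)"
    have "(\<Sum>t\<in>S. d t * \<alpha> t) = d s * \<alpha> s + (\<Sum>t\<in>?S. d t * \<alpha> t)"
      using assms by (intro sum.remove)
    also have "(\<Sum>t\<in>?S. d t * \<alpha> t) = (\<Sum>t\<in>?S. c t * \<alpha> t)"
      by (intro sum.cong) (auto simp: d_def)
    finally have "(\<Sum>t\<in>S. d t * \<alpha> t) = 0"
      using c by (simp add: d_def)
    then have "d s = 0"
      using c(2) F \<open>s \<in> S\<close>
      by (intro subfield_independentD[OF ind, of d s]) (auto simp: d_def subfield_closed[OF F])
    then show False by (simp add: d_def)
  qed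
  ultimately obtain \<phi> where \<phi>: "subfield_functional F \<phi>" "\<And>x. x \<in> ?U \<Longrightarrow> \<phi> x = 0" "\<phi> (\<alpha> s) = 1"
    by (rule subfield_functional_exists[OF F]) blast
  have "\<alpha> t \<in> ?U" if "t \<in> ?S" for t
  proof -
    have "(\<Sum>r\<in>?S. (if r = t then 1 else 0) * \<alpha> r) = (\<Sum>r\<in>?S. if r = t then \<alpha> r else 0)"
      by (intro sum.cong) auto
    also have "\<dots> = \<alpha> t"
      using that assms(3) by (simp add: sum.delta)
    finally have "\<alpha> t = (\<Sum>r\<in>?S. (if r = t then 1 else 0) * \<alpha> r)
        \<and> (\<forall>r\<in>?S. (if r = t then 1 else 0) \<in> F)"
      by (simp add: subfield_closed[OF F])
    then show ?thesis
      by (intro CollectI exI[of _ "\<lambda>r. if r = t then 1 else 0"])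
  qed
  then show thesis using \<phi> by (intro that[of \<phi>]) blast+
qed

section \<open>The least elementary linear subspace containing a component\<close>

text \<open>The dual functional at \<open>\<alpha> s\<close> is applied coordinatewise to two
  expansions of one vector, over \<open>S\<close> and over a generating set \<open>T\<close> of
  \<open>W\<close>. Entries of \<open>S\<close> and \<open>T\<close> lie in \<open>F\<close> and act
  as scalars, so only the coefficients change: the first expansion becomes \<open>s\<close>, the
  second stays in \<open>W\<close>.\<close>

lemma basis_subset_ELS:
  fixes F :: "'a::{field,finite} set" and S W :: "('a ^ 'n::finite) set"
  assumes F: "is_subfield F" and S: "\<And>s i. s \<in> S \<Longrightarrow> s $ i \<in> F"
    and ind: "subfield_independent F \<alpha> S"
    and W: "is_ELS F W" and mem: "(\<Sum>s\<in>S. \<alpha> s *s s) \<in> W"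
  shows "S \<subseteq> W"
proof
  fix s assume s: "s \<in> S"
  obtain T where T: "vec.span T = W" "\<And>t i. t \<in> T \<Longrightarrow> t $ i \<in> F"
    using W by (auto simp: is_ELS_def)
  obtain \<beta> where \<beta>: "(\<Sum>s\<in>S. \<alpha> s *s s) = (\<Sum>t\<in>T. \<beta> t *s t)"
    using mem T(1) vec.span_finite[of T] by auto
  obtain \<phi> where \<phi>: "subfield_functional F \<phi>" "\<phi> (\<alpha> s) = 1" "\<And>t. t \<in> S - {s} \<Longrightarrow> \<phi> (\<alpha> t) = 0"
    using dual_functional_exists[OF F ind _ s] by auto
  have "s $ i = (\<Sum>t\<in>T. \<phi> (\<beta> t) *s t) $ i" for i
  proof -
    have "s $ i = (\<Sum>t\<in>S. \<phi> (\<alpha> t) * t $ i)"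
      using s \<phi>(2,3) by (subst sum.remove[of _ s]) auto
    also have "\<dots> = \<phi> (\<Sum>t\<in>S. \<alpha> t * t $ i)"
      by (rule subfield_functional_sum[OF F \<phi>(1), symmetric]) (rule S)
    also have "(\<Sum>t\<in>S. \<alpha> t * t $ i) = (\<Sum>t\<in>T. \<beta> t * t $ i)"
      using arg_cong[OF \<beta>, of "\<lambda>x. x $ i"] by simp
    also have "\<phi> \<dots> = (\<Sum>t\<in>T. \<phi> (\<beta> t) * t $ i)"
      by (rule subfield_functional_sum[OF F \<phi>(1)]) (rule T(2))
    finally show ?thesis by simp
  qed
  then have "s = (\<Sum>t\<in>T. \<phi> (\<beta> t) *s t)"
    by (simp add: vec_eq_iff)
  also have "\<dots> \<in> vec.span T"
    by (intro vec.span_sum vec.span_scale vec.span_base)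
  finally show "s \<in> W" using T(1) by simp
qed

text \<open>The joined bases of \<open>A\<close> and \<open>B\<close> have at most
  \<open>a + b\<close> elements, so the rank bound makes the coefficients of \<open>x + y\<close>
  independent; those of \<open>x\<close> alone form a subfamily, which forces the basis of
  \<open>A\<close> into \<open>W\<close>.\<close>

lemma ELS_component_least:
  fixes F :: "'a::{field,finite} set" and A B W :: "('a ^ 'n::finite) set"
  assumes F: "is_subfield F" and A: "A \<in> ELS F a" and B: "B \<in> ELS F b" and AB: "A \<inter> B = {0}"
    and x: "x \<in> A" and y: "y \<in> B" and rank: "a + b \<le> rank_over F (x + y)"
    and W: "is_ELS F W" "x \<in> W"
  shows "A \<subseteq> W"
proof -
  obtain S where S: "vec.independent S" "vec.span S = A" "\<And>s i. s \<in> S \<Longrightarrow> s $ i \<in> F"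
    using A by (auto simp: ELS_def is_ELS_def)
  obtain T where T: "vec.independent T" "vec.span T = B" "\<And>t i. t \<in> T \<Longrightarrow> t $ i \<in> F"
    using B by (auto simp: ELS_def is_ELS_def)
  have "card S = a"
    using A S vec.dim_span_eq_card_independent[of S] by (auto simp: ELS_def)
  moreover have "card T = b"
    using B T vec.dim_span_eq_card_independent[of T] by (auto simp: ELS_def)
  ultimately have card: "card (S \<union> T) \<le> a + b"
    using card_Un_le[of S T] by simp
  have disj: "S \<inter> T = {}"
  proof -
    have "S \<inter> T \<subseteq> A \<inter> B"
      using S(2) T(2) vec.span_superset by blast
    moreover have "0 \<notin> S"
      using S(1) vec.dependent_zero by blast
    ultimately show ?thesis using AB by auto
  qed
  obtain \<alpha> where \<alpha>: "x = (\<Sum>s\<in>S. \<alpha> s *s s)"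
    using x S(2) vec.span_finite[of S] by auto
  obtain \<beta> where \<beta>: "y = (\<Sum>t\<in>T. \<beta> t *s t)"
    using y T(2) vec.span_finite[of T] by auto
  \<comment> \<open>One coefficient family for both bases; by disjointness it agrees with
    \<open>\<beta>\<close> on \<open>T\<close>.\<close>
  define \<gamma> where "\<gamma> s = (if s \<in> S then \<alpha> s else \<beta> s)" for s
  have x': "x = (\<Sum>s\<in>S. \<gamma> s *s s)"
    unfolding \<alpha> by (intro sum.cong) (auto simp: \<gamma>_def)
  have y': "y = (\<Sum>t\<in>T. \<gamma> t *s t)"
    unfolding \<beta> using disj by (intro sum.cong) (auto simp: \<gamma>_def)
  have "x + y = (\<Sum>s\<in>S \<union> T. \<gamma> s *s s)"
    unfolding x' y' using disj by (intro sum.union_disjoint[symmetric]) auto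
  then have "subfield_independent F \<gamma> (S \<union> T)"
    using card rank S(3) T(3) by (intro coefficients_independent[OF F]) auto
  then have "subfield_independent F \<gamma> S"
    by (rule subfield_independent_subset[OF F]) auto
  then have "S \<subseteq> W"
    using W x' by (intro basis_subset_ELS[OF F S(3), where \<alpha> = \<gamma>]) auto
  then show ?thesis
    using W(1) S(2) vec.span_minimal[of S W] by (simp add: is_ELS_def)
qed

section \<open>Projections and injectivity\<close>

lemma proj_along_decomp:
  assumes "is_direct_sum A B V" "u \<in> V"
  shows "proj_along A B u \<in> A" "u - proj_along A B u \<in> B"
proof -
  have A: "vec.subspace A" and B: "vec.subspace B" and AB: "A \<inter> B = {0}"
    using assms by (auto simp: is_direct_sum_def)
  obtain x y where xy: "x \<in> A" "y \<in> B" "u = x + y"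
    using assms by (auto simp: is_direct_sum_def)
  have "proj_along A B u = x"
    unfolding proj_along_def
  proof (rule the_equality)
    show "x \<in> A \<and> (\<exists>y\<in>B. u = x + y)" using xy by blast
    fix x' assume "x' \<in> A \<and> (\<exists>y\<in>B. u = x' + y)"
    then obtain y' where *: "x' \<in> A" "y' \<in> B" "u = x' + y'" by blast
    \<comment> \<open>The difference of two decompositions lies in both summands, hence is
      zero.\<close>
    have "x' - x = y - y'" using xy(3) *(3) by (simp add: algebra_simps)
    then have "x' - x \<in> A \<inter> B"
      using vec.subspace_diff[OF A *(1) xy(1)] vec.subspace_diff[OF B xy(2) *(2)] by simp
    then show "x' = x" using AB by simp
  qed
  then show "proj_along A B u \<in> A" "u - proj_along A B u \<in> B"
    using xy by simp_all
qed

text \<open>Equal projections \<open>x\<close> also give equal complements \<open>u - x\<close>, so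
  minimality applies to both members of each pair, and exchanging the pairs gives the reverse
  inclusions.\<close>

lemma inj_on_f_proj:
  fixes F :: "'a::{field,finite} set" and V :: "('a ^ 'n::finite) set"
  assumes F: "is_subfield F" and u: "u \<in> V" and rank: "a + b \<le> rank_over F u"
  shows "inj_on (f_proj u) (ELS_decompositions F a b V)"
proof (rule inj_onI)
  have least: "A \<subseteq> A' \<and> B \<subseteq> B'"
    if AB: "(A, B) \<in> ELS_decompositions F a b V" and AB': "(A', B') \<in> ELS_decompositions F a b V"
      and eq: "f_proj u (A, B) = f_proj u (A', B')" for A B A' B'
  proof -
    define x where "x = f_proj u (A, B)"
    have *: "x \<in> A" "u - x \<in> B" "x \<in> A'" "u - x \<in> B'"
      using AB AB' eq u proj_along_decomp[of A B V u] proj_along_decomp[of A' B' V u]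
      by (auto simp: x_def f_proj_def ELS_decompositions_def)
    have E: "A \<in> ELS F a" "B \<in> ELS F b" "A \<inter> B = {0}" "is_ELS F A'" "is_ELS F B'"
      using AB AB' by (auto simp: ELS_decompositions_def ELS_def is_direct_sum_def)
    have "A \<subseteq> A'"
      using * E rank by (intro ELS_component_least[OF F E(1,2,3) *(1,2)]) auto
    moreover have "B \<subseteq> B'"
      using * E rank by (intro ELS_component_least[OF F E(2,1) _ *(2,1)]) (auto simp: add.commute)
    ultimately show ?thesis ..
  qed
  fix P Q assume P: "P \<in> ELS_decompositions F a b V" and Q: "Q \<in> ELS_decompositions F a b V"
    and eq: "f_proj u P = f_proj u Q"
  show "P = Q"
    using least[of "fst P" "snd P" "fst Q" "snd Q"] least[of "fst Q" "snd Q" "fst P" "snd P"] P Q eq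
    by (simp add: prod_eq_iff subset_antisym)
qed

lemma is_direct_sum_commute: "is_direct_sum A B V \<longleftrightarrow> is_direct_sum B A V"
proof -
  have "{x + y | x y. x \<in> A \<and> y \<in> B} = {x + y | x y. x \<in> B \<and> y \<in> A}"
    by (intro Collect_cong) (metis add.commute)
  then show ?thesis
    by (auto simp: is_direct_sum_def Int_commute)
qed

lemma ELS_decompositions_swap:
  assumes "P \<in> ELS_decompositions F a b V"
  shows "prod.swap P \<in> ELS_decompositions F b a V"
  using assms is_direct_sum_commute by (auto simp: ELS_decompositions_def)

theorem lemma4:
  fixes F :: "'a::{field,finite} set"
    and q m v a :: nat
    and V :: "('a ^ 'n::finite) set"
    and u :: "'a ^ 'n"
  assumes "primepow q" and "m \<ge> 1"
    and "CARD('a) = q ^ m"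
    and "is_subfield F" and "card F = q"
    and "V \<in> ELS F v"
    and "u \<in> V" and "rank_over F u = v"
    and "a \<le> v"
  shows "inj_on (f_proj u) (ELS_decompositions F a (v - a) V) \<and>
         inj_on (g_proj u) (ELS_decompositions F a (v - a) V)"
proof
  show "inj_on (f_proj u) (ELS_decompositions F a (v - a) V)"
    using assms by (intro inj_on_f_proj) auto
  \<comment> \<open>\<open>g_proj u\<close> is \<open>f_proj u\<close> after exchanging the
    summands, so the case of exchanged dimensions transfers along \<open>prod.swap\<close>.\<close>
  have "inj_on (f_proj u) (ELS_decompositions F (v - a) a V)"
    using assms by (intro inj_on_f_proj) auto
  then have "inj_on (f_proj u) (prod.swap ` ELS_decompositions F a (v - a) V)"
    by (rule inj_on_subset) (auto intro: ELS_decompositions_swap simp del: swap_simp)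
  then have "inj_on (f_proj u \<circ> prod.swap) (ELS_decompositions F a (v - a) V)"
    by (intro comp_inj_on) auto
  also have "f_proj u \<circ> prod.swap = g_proj u"
    by (auto simp: f_proj_def g_proj_def)
  finally show "inj_on (g_proj u) (ELS_decompositions F a (v - a) V)" .
qed

end
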